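(* Let $\mathcal{V}$ be a real vector space of finite dimension $N$, let $F_1,\dots,F_N$ be linearly independent linear functionals on $\mathcal{V}$, let $\mathfrak{S}\subseteq\mathcal{V}$ be a linear subspace, and let $S\le N$ be an integer such that $F_1,\dots,F_S$ are $\mathfrak{S}$-identifying. Let $\Pi^{S}:\mathcal{V}\to\mathfrak{S}$ be the associated projection operator and $\mathcal{V}_S\subseteq\mathcal{V}$ the associated serendipity space (both defined in the context). Then: (i) the degrees of freedom $F_1,\dots,F_S$ are unisolvent for $\mathcal{V}_S$, i.e. the map $v\mapsto (F_1(v),\dots,F_S(v))$ is a bijection from $\mathcal{V}_S$ onto $\mathbb{R}^S$; (ii) if $v\in\mathcal{V}_S$, the remaining values $F_{S+1}(v),\dots,F_N(v)$ can be computed from $F_1(v),\dots,F_S(v)$ (that is, they are determined as functions of $F_1(v),\dots,F_S(v)$); (iii) $\mathfrak{S}\subseteq\mathcal{V}_S$.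
   Context: The functionals $F_1,\dots,F_S$ are called $\mathfrak{S}$-identifying if for every $q\in\mathfrak{S}$: $F_1(q)=\dots=F_S(q)=0$ implies $q=0$. Define $D_S:\mathcal{V}\to\mathbb{R}^S$ by $D_S(v):=(F_1(v),\dots,F_S(v))$; being $\mathfrak{S}$-identifying means that $D_S$ is injective on $\mathfrak{S}$. For $v\in\mathcal{V}$, $\Pi^S v$ is defined as the unique element of $\mathfrak{S}$ such that $$[D_S(\Pi^S v),D_S q]_{\mathbb{R}^S}=[D_S v,D_S q]_{\mathbb{R}^S}\quad\text{for all } q\in\mathfrak{S},$$ where $[\cdot,\cdot]_{\mathbb{R}^S}$ is the Euclidean scalar product of $\mathbb{R}^S$. The serendipity space is $$\mathcal{V}_S:=\{v\in\mathcal{V}:\ F_i(v)=F_i(\Pi^S v)\ \text{for } i=S+1,\dots,N\}.$$ *)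

theory Defs
  imports Complex_Main "HOL-Library.FuncSet"
begin

text \<open>
  Functionals are indexed from 1. The space \<open>\<real>\<^sup>S\<close> is the set \<^term>\<open>{1..S::nat} \<rightarrow>\<^sub>E (UNIV :: real set)\<close>
  of real tuples indexed by \<^term>\<open>{1..S}\<close> (extensional functions, so that a tuple is determined
  by its entries); for \<open>S = 0\<close> it has exactly one element.
\<close>

text \<open>
  Independence as a family, over an arbitrary real vector space: the linear combination
  vanishes as a functional, that is, at every vector.
\<close>

definition lin_indep_functionals :: "nat \<Rightarrow> (nat \<Rightarrow> 'v::real_vector \<Rightarrow> real) \<Rightarrow> bool" where
  "lin_indep_functionals N F \<longleftrightarrow>
     (\<forall>c :: nat \<Rightarrow> real. (\<forall>v. (\<Sum>i\<in>{1..N}. c i * F i v) = 0) \<longrightarrow> (\<forall>i\<in>{1..N}. c i = 0))"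

definition identifying :: "(nat \<Rightarrow> 'v::real_vector \<Rightarrow> real) \<Rightarrow> nat \<Rightarrow> 'v set \<Rightarrow> bool" where
  "identifying F S Q \<longleftrightarrow> (\<forall>q\<in>Q. (\<forall>i\<in>{1..S}. F i q = 0) \<longrightarrow> q = 0)"

definition dof_map :: "(nat \<Rightarrow> 'v::real_vector \<Rightarrow> real) \<Rightarrow> nat \<Rightarrow> 'v \<Rightarrow> (nat \<Rightarrow> real)" where
  "dof_map F S v = (\<lambda>i\<in>{1..S}. F i v)"

definition euclid_prod :: "nat \<Rightarrow> (nat \<Rightarrow> real) \<Rightarrow> (nat \<Rightarrow> real) \<Rightarrow> real" where
  "euclid_prod S x y = (\<Sum>i\<in>{1..S}. x i * y i)"

definition serendipity_proj ::
    "(nat \<Rightarrow> 'v::real_vector \<Rightarrow> real) \<Rightarrow> nat \<Rightarrow> 'v set \<Rightarrow> 'v \<Rightarrow> 'v" where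
  "serendipity_proj F S Q v =
     (THE p. p \<in> Q \<and>
        (\<forall>q\<in>Q. euclid_prod S (dof_map F S p) (dof_map F S q)
              = euclid_prod S (dof_map F S v) (dof_map F S q)))"

definition serendipity_space ::
    "(nat \<Rightarrow> 'v::real_vector \<Rightarrow> real) \<Rightarrow> nat \<Rightarrow> nat \<Rightarrow> 'v set \<Rightarrow> 'v set" where
  "serendipity_space F N S Q = {v. \<forall>i\<in>{S+1..N}. F i v = F i (serendipity_proj F S Q v)}"

end

theory Submission
  imports Defs
begin

text \<open>
  Independent functionals on a space of matching dimension admit a dual basis, so a vector is
  the same as its $N$ values. The projection of $v$ depends only on $D_S(v)$; hence in
  $\mathcal{V}_S$ the first $S$ values are free and determine the remaining ones. Elements of
  $\mathfrak{S}$ are fixed by the projection because $D_S$ is injective on $\mathfrak{S}$.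
\<close>

text \<open>Induction on \<open>I\<close>: once values on \<open>I\<close> can be prescribed freely,
  independence supplies a vector in the common kernel of these functionals on which
  \<open>F a\<close> is nonzero, and it corrects the value at \<open>a\<close> alone.\<close>

lemma independent_functionals_attain_values:
  fixes F :: "'i \<Rightarrow> 'v::real_vector \<Rightarrow> real"
  assumes "finite I"
    and "\<And>i. i \<in> I \<Longrightarrow> linear (F i)"
    and "\<And>c. (\<And>v. (\<Sum>i\<in>I. c i * F i v) = 0) \<Longrightarrow> \<forall>i\<in>I. c i = 0"
  shows "\<exists>v. \<forall>i\<in>I. F i v = x i"
  using assms
proof (induction I arbitrary: x rule: finite_induct)
  case empty
  then show ?case by simp
next
  case (insert a I)
  have linI: "linear (F i)" if "i \<in> I" for i
    using insert.prems(1) that by simp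
  have lina: "linear (F a)"
    using insert.prems(1) by simp
  have indI: "\<forall>i\<in>I. c i = 0" if "\<And>v. (\<Sum>i\<in>I. c i * F i v) = 0" for c
  proof -
    \<comment> \<open>A relation over \<open>I\<close> becomes one over \<open>insert a I\<close>
      with coefficient 0 at \<open>a\<close>.\<close>
    have "(\<Sum>i\<in>insert a I. (c(a := 0)) i * F i v) = 0" for v
    proof -
      have "(\<Sum>i\<in>I. (c(a := 0)) i * F i v) = (\<Sum>i\<in>I. c i * F i v)"
        using insert.hyps(2) by (intro sum.cong) auto
      then show ?thesis
        using insert.hyps that by simp
    qed
    from insert.prems(2)[OF this] have "\<forall>i\<in>insert a I. (c(a := 0)) i = 0" .
    then show ?thesis
      using insert.hyps(2) by (simp add: fun_upd_def) metis
  qed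
  have attain: "\<exists>v. \<forall>i\<in>I. F i v = y i" for y
    by (rule insert.IH[OF linI indI])
  have "\<forall>j. \<exists>v. \<forall>i\<in>I. F i v = (if i = j then 1 else 0)"
    by (intro allI attain)
  then obtain e where e: "\<And>j i. i \<in> I \<Longrightarrow> F i (e j) = (if i = j then 1 else 0)"
    using choice[of "\<lambda>j v. \<forall>i\<in>I. F i v = (if i = j then 1 else 0)"] by blast
  have "\<exists>u. (\<forall>i\<in>I. F i u = 0) \<and> F a u \<noteq> 0"
  proof (rule ccontr)
    assume "\<nexists>u. (\<forall>i\<in>I. F i u = 0) \<and> F a u \<noteq> 0"
    then have ker: "F a u = 0" if "\<forall>i\<in>I. F i u = 0" for u
      using that by blast
    have "F a v = (\<Sum>i\<in>I. F i v * F a (e i))" for v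
    proof -
      \<comment> \<open>Subtracting the dual expansion moves \<open>v\<close> into the common
        kernel, where \<open>F a\<close> vanishes by assumption; so \<open>F a\<close> is a
        combination of the other functionals.\<close>
      let ?u = "v - (\<Sum>j\<in>I. F j v *\<^sub>R e j)"
      have "F i ?u = 0" if "i \<in> I" for i
        using that insert.hyps(1) linI[OF that] e[OF that]
        by (simp add: linear_diff linear_sum linear_scale if_distrib[of "\<lambda>t. _ * t"] cong: if_cong)
      then have "F a ?u = 0"
        using ker by blast
      then show ?thesis
        using lina by (simp add: linear_diff linear_sum linear_scale)
    qed
    define c where "c i = (if i = a then 1 else - F a (e i))" for i
    have "(\<Sum>i\<in>insert a I. c i * F i v) = 0" for v
    proof -
      have "(\<Sum>i\<in>I. c i * F i v) = (\<Sum>i\<in>I. - (F i v * F a (e i)))"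
        using insert.hyps(2) by (intro sum.cong) (auto simp: c_def)
      then show ?thesis
        using insert.hyps \<open>F a v = _\<close> by (simp add: c_def sum_negf)
    qed
    from insert.prems(2)[OF this] show False
      by (simp add: c_def)
  qed
  then obtain u where u: "\<forall>i\<in>I. F i u = 0" "F a u \<noteq> 0"
    by blast
  obtain v where v: "\<forall>i\<in>I. F i v = x i"
    using attain by blast
  \<comment> \<open>Adding multiples of \<open>u\<close> changes no value on \<open>I\<close>; the
    factor is the one that shifts \<open>F a v\<close> to \<open>x a\<close>.\<close>
  have "F i (v + ((x a - F a v) / F a u) *\<^sub>R u) = x i" if "i \<in> insert a I" for i
    using that u v lina linI by (auto simp: linear_add linear_scale)
  then show ?case
    by blast
qed

text \<open>A nonzero common zero \<open>w\<close> would lie outside the span of the dual vectors,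
  so adjoining it to them would give an independent set larger than the dimension.\<close>

lemma dual_family_separates:
  fixes F :: "'i \<Rightarrow> 'v::real_vector \<Rightarrow> real"
  assumes fin: "finite B" "span B = (UNIV :: 'v set)"
    and I: "finite I" "dim (UNIV :: 'v set) \<le> card I"
    and lin: "\<And>i. i \<in> I \<Longrightarrow> linear (F i)"
    and e: "\<And>i j. i \<in> I \<Longrightarrow> j \<in> I \<Longrightarrow> F i (e j) = (if i = j then 1 else 0)"
    and w: "\<And>i. i \<in> I \<Longrightarrow> F i w = 0"
  shows "w = 0"
proof (rule ccontr)
  assume "w \<noteq> 0"
  have inj: "inj_on e I"
    using e by (metis inj_onI zero_neq_one)
  have vanish: "F i v = 0"
    if "i \<in> I" "v \<in> span A" "\<And>a. a \<in> A \<Longrightarrow> F i a = 0" for i v and A :: "'v set"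
    using linear_eq_on_span[OF lin[OF that(1)] linear_zero _ that(2)] that(3) by blast
  have indep: "independent (e ` I)"
  proof
    assume "dependent (e ` I)"
    then obtain j where j: "j \<in> I" "e j \<in> span (e ` I - {e j})"
      unfolding dependent_def by blast
    \<comment> \<open>\<open>F j\<close> vanishes on all the other dual vectors, hence on their
      span, yet equals 1 at \<open>e j\<close>.\<close>
    have "F j (e j) = 0"
      using e j(1) by (intro vanish[OF j]) auto
    then show False
      using e j(1) by simp
  qed
  \<comment> \<open>Both sides are linear in \<open>v\<close> and agree on each dual vector.\<close>
  have "v = (\<Sum>j\<in>I. F j v *\<^sub>R e j)" if "v \<in> span (e ` I)" for v
  proof (rule linear_eq_on_span[OF linear_ident _ _ that])
    show "linear (\<lambda>v. \<Sum>j\<in>I. F j v *\<^sub>R e j)"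
      using lin by (intro linear_compose_sum ballI linear_compose[unfolded o_def, OF _ linear_scaleR_left])
    show "b = (\<Sum>j\<in>I. F j b *\<^sub>R e j)" if b: "b \<in> e ` I" for b
      using b e I(1) by (auto simp: if_distrib[of "\<lambda>t. t *\<^sub>R _"] cong: if_cong)
  qed
  then have "w \<notin> span (e ` I)"
    using w \<open>w \<noteq> 0\<close> by (metis (no_types, lifting) scale_zero_left sum.neutral)
  then have "independent (insert w (e ` I))" and notin: "w \<notin> e ` I"
    using indep by (auto simp: independent_insert span_base)
  moreover obtain C :: "'v set" where C: "independent C" "UNIV \<subseteq> span C" "card C = dim (UNIV :: 'v set)"
    using basis_exists[of UNIV] by metis
  \<comment> \<open>Since \<open>card\<close> is 0 on infinite sets, \<open>card C\<close> is a
    meaningful bound only once \<open>C\<close> is known to be finite.\<close>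
  moreover have "finite C"
    using independent_span_bound[OF fin(1) C(1)] fin(2) by simp
  ultimately have "card (insert w (e ` I)) \<le> card C"
    using independent_span_bound[of C "insert w (e ` I)"] by blast
  moreover have "card (insert w (e ` I)) = Suc (card I)"
    using notin I(1) inj by (simp add: card_image)
  ultimately show False
    using C(3) I(2) by simp
qed

lemma dof_map_eq_iff: "dof_map F S v = dof_map F S w \<longleftrightarrow> (\<forall>i\<in>{1..S}. F i v = F i w)"
  by (auto simp: dof_map_def restrict_def fun_eq_iff)

text \<open>The equations for the projection involve \<open>v\<close> only through its degrees of
  freedom, so both \<open>THE\<close> terms describe the same element.\<close>

lemma serendipity_proj_cong:
  "dof_map F S v = dof_map F S w \<Longrightarrow> serendipity_proj F S Q v = serendipity_proj F S Q w"
  unfolding serendipity_proj_def by simp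

text \<open>An element of \<open>Q\<close> solves its own projection equations; injectivity of
  \<open>dof_map F S\<close> on \<open>Q\<close> makes it the only solution, as \<open>THE\<close>
  requires.\<close>

lemma serendipity_proj_ident:
  assumes lin: "\<And>i. i \<in> {1..S} \<Longrightarrow> linear (F i)"
    and "subspace Q" "identifying F S Q" "q \<in> Q"
  shows "serendipity_proj F S Q q = q"
  unfolding serendipity_proj_def
proof (rule the_equality)
  show "q \<in> Q \<and> (\<forall>r\<in>Q. euclid_prod S (dof_map F S q) (dof_map F S r)
      = euclid_prod S (dof_map F S q) (dof_map F S r))"
    using \<open>q \<in> Q\<close> by blast
next
  fix p
  assume p: "p \<in> Q \<and> (\<forall>r\<in>Q. euclid_prod S (dof_map F S p) (dof_map F S r)
      = euclid_prod S (dof_map F S q) (dof_map F S r))"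
  \<comment> \<open>Testing with \<open>p - q\<close> itself turns the equations into the vanishing
    of a sum of squares.\<close>
  have pq: "p - q \<in> Q"
    using p assms by (simp add: subspace_diff)
  then have "euclid_prod S (dof_map F S p) (dof_map F S (p - q))
      = euclid_prod S (dof_map F S q) (dof_map F S (p - q))"
    using p by blast
  then have "(\<Sum>i\<in>{1..S}. F i p * F i (p - q)) = (\<Sum>i\<in>{1..S}. F i q * F i (p - q))"
    by (simp add: euclid_prod_def dof_map_def)
  moreover have "(F i (p - q))\<^sup>2 = F i p * F i (p - q) - F i q * F i (p - q)" if "i \<in> {1..S}" for i
    unfolding power2_eq_square left_diff_distrib[symmetric] linear_diff[OF lin[OF that]] ..
  ultimately have "(\<Sum>i\<in>{1..S}. (F i (p - q))\<^sup>2) = 0"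
    by (simp add: sum_subtractf)
  then have "\<forall>i\<in>{1..S}. F i (p - q) = 0"
    by (simp add: sum_nonneg_eq_0_iff)
  then have "p - q = 0"
    using pq \<open>identifying F S Q\<close> unfolding identifying_def by blast
  then show "p = q"
    by simp
qed

theorem proposition3p2:
  fixes F :: "nat \<Rightarrow> 'v::real_vector \<Rightarrow> real"
    and N S :: nat
    and Q :: "'v set"
  assumes fin_dim: "\<exists>B :: 'v set. finite B \<and> span B = UNIV"
    and dim_N: "dim (UNIV :: 'v set) = N"
    and lin: "\<And>i. i \<in> {1..N} \<Longrightarrow> linear (F i)"
    and indep: "lin_indep_functionals N F"
    and subsp: "subspace Q"
    and S_le_N: "S \<le> N"
    and ident: "identifying F S Q"
  shows "bij_betw (dof_map F S) (serendipity_space F N S Q) ({1..S} \<rightarrow>\<^sub>E (UNIV :: real set))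
    \<and> (\<exists>G :: (nat \<Rightarrow> real) \<Rightarrow> nat \<Rightarrow> real.
         \<forall>v\<in>serendipity_space F N S Q. \<forall>i\<in>{S+1..N}. F i v = G (dof_map F S v) i)
    \<and> Q \<subseteq> serendipity_space F N S Q"
proof -
  let ?V = "serendipity_space F N S Q"
  let ?P = "serendipity_proj F S Q"
  have attain: "\<exists>v. \<forall>i\<in>{1..N}. F i v = x i" for x
    by (rule independent_functionals_attain_values)
      (use lin indep in \<open>auto simp: lin_indep_functionals_def\<close>)
  have "\<forall>j. \<exists>v. \<forall>i\<in>{1..N}. F i v = (if i = j then 1 else 0)"
    by (intro allI attain)
  then obtain e where e: "\<And>j i. i \<in> {1..N} \<Longrightarrow> F i (e j) = (if i = j then 1 else 0)"
    using choice[of "\<lambda>j v. \<forall>i\<in>{1..N}. F i v = (if i = j then 1 else 0)"] by blast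
  obtain B :: "'v set" where B: "finite B" "span B = UNIV"
    using fin_dim by blast
  have separate: "v = w" if "\<And>i. i \<in> {1..N} \<Longrightarrow> F i v = F i w" for v w
  proof -
    have "v - w = 0"
      by (rule dual_family_separates[OF B, of "{1..N}" F e])
        (use that lin e dim_N in \<open>auto simp: linear_diff\<close>)
    then show ?thesis by simp
  qed
  \<comment> \<open>Each side is the value of \<open>F i\<close> at a projection, and the two
    projections coincide.\<close>
  have rest: "F i v = F i w"
    if "v \<in> ?V" "w \<in> ?V" "dof_map F S v = dof_map F S w" "i \<in> {S+1..N}" for v w i
    using that serendipity_proj_cong[OF that(3), of Q] by (simp add: serendipity_space_def)
  have "inj_on (dof_map F S) ?V"
  proof (rule inj_onI)
    fix v w assume vw: "v \<in> ?V" "w \<in> ?V" "dof_map F S v = dof_map F S w"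
    show "v = w"
    proof (rule separate)
      fix i assume "i \<in> {1..N}"
      then consider "i \<in> {1..S}" | "i \<in> {S+1..N}" by force
      then show "F i v = F i w"
        using vw(3) rest[OF vw] by cases (auto simp: dof_map_eq_iff)
    qed
  qed
  moreover have "x \<in> dof_map F S ` ?V" if x: "x \<in> {1..S} \<rightarrow>\<^sub>E UNIV" for x
  proof -
    \<comment> \<open>Taking the remaining values of \<open>v\<close> from its own projection would
      be circular. The auxiliary \<open>w\<close> has the same first \<open>S\<close> values, hence
      the same projection; its other values are irrelevant.\<close>
    obtain w where w: "\<forall>i\<in>{1..N}. F i w = x i"
      using attain by blast
    obtain v where v: "\<forall>i\<in>{1..N}. F i v = (if i \<le> S then x i else F i (?P w))"
      using attain[of "\<lambda>i. if i \<le> S then x i else F i (?P w)"] by blast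
    have dof: "dof_map F S v = dof_map F S w"
      using v w S_le_N by (simp add: dof_map_eq_iff)
    have "v \<in> ?V"
      using v serendipity_proj_cong[OF dof, of Q] by (simp add: serendipity_space_def)
    moreover have "dof_map F S v = x"
      using x v S_le_N by (intro PiE_ext[OF _ x]) (auto simp: dof_map_def)
    ultimately show ?thesis by blast
  qed
  moreover have "dof_map F S v \<in> {1..S} \<rightarrow>\<^sub>E UNIV" for v
    by (simp add: dof_map_def)
  ultimately have "bij_betw (dof_map F S) ?V ({1..S} \<rightarrow>\<^sub>E UNIV)"
    unfolding bij_betw_def by blast
  \<comment> \<open>Injectivity lets the inverse of \<open>dof_map F S\<close> on \<open>?V\<close>
    recover \<open>v\<close> from its tuple; \<open>G\<close> then applies
    \<open>F i\<close>.\<close>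
  moreover have "\<forall>v\<in>?V. \<forall>i\<in>{S+1..N}.
      F i v = F i (inv_into ?V (dof_map F S) (dof_map F S v))"
    using \<open>inj_on (dof_map F S) ?V\<close> by simp
  then have "\<exists>G. \<forall>v\<in>?V. \<forall>i\<in>{S+1..N}. F i v = G (dof_map F S v) i"
    by (intro exI[of _ "\<lambda>x i. F i (inv_into ?V (dof_map F S) x)"])
  \<comment> \<open>On \<open>Q\<close> the projection is the identity, so the condition defining
    \<open>?V\<close> becomes trivial.\<close>
  moreover have "Q \<subseteq> ?V"
    using serendipity_proj_ident[OF _ subsp ident] lin S_le_N
    by (auto simp: serendipity_space_def)
  ultimately show ?thesis
    by blast
qed

end
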